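(* Let $\mathbb{X}$ be a Banach space and let $A,B:\mathbb{R}\to L(\mathbb{X})$ be continuous functions such that $\|A(t)\|\le M$ and $\|B(t)\|\le M$ for every $t\in\mathbb{R}$. Suppose that $B$ is a generalized almost periodic function with mean value zero. Consider the equations $$\text{(i)}\ \ \dot x=A(t)x,\qquad \text{(ii)}\ \ \dot x=A(t)x+B(\omega t)x .$$ Let $T(t,s)$ be the evolution operator of (i) and suppose that $\|T(t,s)\|\le Ke^{-\alpha(t-s)}$ for all $t\ge s$, $t,s\in\mathbb{R}$, where $\alpha>0$ and $K>1$. Let $S_\omega(t,s)$ denote the evolution operator of (ii). Then there exist $\tilde K$ and $\omega_0>0$ such that for every $\omega>\omega_0$ $$\|S_\omega(t,s)\|\le\tilde K e^{-\frac{\alpha}{2}(t-s)},\qquad t\ge s .$$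
   Context: $L(\mathbb{X})$ is the Banach space of bounded linear operators on $\mathbb{X}$ with the operator norm. The evolution operator of a linear equation $\dot x=A(t)x$ is $T(t,s)=X(t)X^{-1}(s)$, where $X(t)\in L(\mathbb{X})$ is the operator solution with $X(0)=I$. Let $\mathcal{F}$ be the set of bounded, uniformly continuous functions $A:\mathbb{R}\to L(\mathbb{X})$ whose range is precompact in $L(\mathbb{X})$. A function $A\in\mathcal{F}$ is called generalized almost periodic if there exists $\mathbf{A}\in L(\mathbb{X})$ such that for every $\varepsilon>0$ there is $T_0=T_0(\varepsilon)>0$ with $\big\|\frac1T\int_a^{a+T}A(t)\,dt-\mathbf{A}\big\|<\varepsilon$ for every $T\ge T_0$ and every $a\in\mathbb{R}$ (i.e. uniformly in $a$). The operator $\mathbf{A}=\lim_{T\to\infty}\frac1T\int_a^{a+T}A(t)\,dt$ is called the mean value of $A$. *)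

theory Defs
  imports "HOL-Analysis.Analysis"
begin

definition operator_solution ::
  "(real \<Rightarrow> 'a::banach \<Rightarrow>\<^sub>L 'a) \<Rightarrow> (real \<Rightarrow> 'a \<Rightarrow>\<^sub>L 'a) \<Rightarrow> bool"
  where "operator_solution A X \<longleftrightarrow>
    X 0 = id_blinfun \<and>
    (\<forall>t. (X has_vector_derivative (A t o\<^sub>L X t)) (at t))"

definition inverse_operator :: "('a::banach \<Rightarrow>\<^sub>L 'a) \<Rightarrow> 'a \<Rightarrow>\<^sub>L 'a"
  where "inverse_operator U = (THE V. U o\<^sub>L V = id_blinfun \<and> V o\<^sub>L U = id_blinfun)"

(* For continuous A the operator solution exists on the whole line, is unique, and has
   invertible values, so both definite descriptions below denote the intended objects. *)
definition fundamental_operator ::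
  "(real \<Rightarrow> 'a::banach \<Rightarrow>\<^sub>L 'a) \<Rightarrow> real \<Rightarrow> 'a \<Rightarrow>\<^sub>L 'a"
  where "fundamental_operator A = (THE X. operator_solution A X)"

definition evolution_operator ::
  "(real \<Rightarrow> 'a::banach \<Rightarrow>\<^sub>L 'a) \<Rightarrow> real \<Rightarrow> real \<Rightarrow> 'a \<Rightarrow>\<^sub>L 'a"
  where "evolution_operator A t s =
    fundamental_operator A t o\<^sub>L inverse_operator (fundamental_operator A s)"

(* The class F: in a complete space, precompact means having compact closure. *)
definition class_F :: "(real \<Rightarrow> 'a::banach \<Rightarrow>\<^sub>L 'a) set"
  where "class_F = {A. bounded (range A) \<and> uniformly_continuous_on UNIV A \<and>
    compact (closure (range A))}"

definition has_mean_value ::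
  "(real \<Rightarrow> 'a::banach \<Rightarrow>\<^sub>L 'a) \<Rightarrow> ('a \<Rightarrow>\<^sub>L 'a) \<Rightarrow> bool"
  where "has_mean_value A L \<longleftrightarrow>
    (\<forall>\<epsilon>>0. \<exists>T\<^sub>0>0. \<forall>T\<ge>T\<^sub>0. \<forall>a.
       norm ((1 / T) *\<^sub>R integral {a..a + T} A - L) < \<epsilon>)"

definition generalized_almost_periodic :: "(real \<Rightarrow> 'a::banach \<Rightarrow>\<^sub>L 'a) \<Rightarrow> bool"
  where "generalized_almost_periodic A \<longleftrightarrow> A \<in> class_F \<and> (\<exists>L. has_mean_value A L)"

end

theory Submission
  imports Defs
begin

text \<open>
  Fix a window length $h$ with $K e^{-\alpha h} = \frac12 e^{-\alpha h/2}$. For large $\omega$ the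
  mean value condition makes the primitive $G(t) = \int_s^t B(\omega\tau)\,d\tau$ small on
  $[s, s+h]$, uniformly in $s$: by the mean value when $\omega (t-s)$ is large, and because of the
  factor $1/\omega$ otherwise. The averaging transformation $V = (I - G) S_\omega$ satisfies
  $V' = A V + R$ with $R = A G S_\omega - G (A + B(\omega\,\cdot)) S_\omega$ small, so Gronwall's
  inequality shows that $S_\omega$ is close to $T$ on such windows. Hence
  $\|S_\omega(s+h,s)\| \le e^{-\alpha h/2}$, and iterating this gives the exponential bound.
\<close>

section \<open>A Gronwall bound and primitives on the whole line\<close>

text \<open>The constants are cruder than in the sharp inequality, but only proportionality to
  \<open>norm (D a) + \<rho>\<close> matters later. Uniqueness (both terms zero), growth of
  evolution operators (\<open>\<rho>\<close> zero) and the averaging error (\<open>D a\<close> zero)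
  all come from it.\<close>

lemma gronwall_perturbed:
  fixes D :: "real \<Rightarrow> 'b::real_normed_vector"
  assumes der: "\<And>t. t \<in> {a..b} \<Longrightarrow> (D has_vector_derivative D' t) (at t within {a..b})"
    and bound: "\<And>t. t \<in> {a..b} \<Longrightarrow> norm (D' t) \<le> M * norm (D t) + \<rho>"
    and "0 \<le> M" "0 \<le> \<rho>" and t: "t \<in> {a..b}"
  shows "norm (D t) \<le> 2 * (norm (D a) + \<rho>) * exp ((2 * M + 1) * (t - a))"
proof -
  define L where "L = 2 * M + 1"
  have L: "L \<ge> 1" using \<open>0 \<le> M\<close> by (simp add: L_def)
  \<comment> \<open>No integral is needed: bound the maximum of the exponentially weighted norm.\<close>
  define w where "w s = norm (D s) * exp (- L * (s - a))" for s
  have contD: "continuous_on {a..b} D"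
    unfolding continuous_on_eq_continuous_within
    using der has_vector_derivative_continuous by blast
  then have "continuous_on {a..b} w"
    unfolding w_def by (intro continuous_intros)
  then obtain x where x: "x \<in> {a..b}" and max: "\<And>s. s \<in> {a..b} \<Longrightarrow> w s \<le> w x"
    using continuous_attains_sup[of "{a..b}" w] t by auto
  define m where "m = w x"
  have m0: "0 \<le> m" by (simp add: m_def w_def)
  have le: "norm (D s) \<le> m * exp (L * (s - a))" if "s \<in> {a..b}" for s
  proof -
    have "norm (D s) = w s * exp (L * (s - a))"
      by (simp add: w_def mult_exp_exp)
    with max[OF that] show ?thesis by (simp add: m_def mult_right_mono)
  qed
  \<comment> \<open>With \<open>m\<close> the weighted maximum, the derivative is bounded by
    \<open>(M * m + \<rho>) * exp (L * (s - a))\<close>, where \<open>\<rho>\<close> is absorbed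
    because the exponential is at least 1. A primitive of this bound is
    \<open>q * exp (L * (s - a))\<close>.\<close>
  define q where "q = (M * m + \<rho>) / L"
  have q0: "0 \<le> q" using m0 L \<open>0 \<le> M\<close> \<open>0 \<le> \<rho>\<close> by (simp add: q_def)
  have main: "norm (D x - D a) \<le> q * exp (L * (x - a)) - q"
  proof (cases "a = x")
    case False
    with x have ax: "a < x" by simp
    have "norm (D x - D a) \<le> q * exp (L * (x - a)) - q * exp (L * (a - a))"
    proof (rule differentiable_bound_general[OF ax])
      show "continuous_on {a..x} D"
        using contD x by (auto intro: continuous_on_subset)
      show "continuous_on {a..x} (\<lambda>s. q * exp (L * (s - a)))"
        by (intro continuous_intros)
      fix s assume s: "a < s" "s < x"
      with x have s': "s \<in> {a..b}" "s \<in> interior {a..b}" by auto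
      show "(D has_vector_derivative D' s) (at s)"
        using der[OF s'(1)] at_within_interior[OF s'(2)] by simp
      show "((\<lambda>s. q * exp (L * (s - a))) has_vector_derivative
          (M * m + \<rho>) * exp (L * (s - a))) (at s)"
        unfolding has_real_derivative_iff_has_vector_derivative[symmetric]
        using L by (auto intro!: derivative_eq_intros simp: q_def)
      have "norm (D' s) \<le> M * (m * exp (L * (s - a))) + \<rho> * exp (L * (s - a))"
        using bound[OF s'(1)] le[OF s'(1)] \<open>0 \<le> M\<close> \<open>0 \<le> \<rho>\<close> s L
          mult_left_mono[of "norm (D s)" "m * exp (L * (s - a))" M]
          mult_left_mono[of 1 "exp (L * (s - a))" \<rho>] by auto
      then show "norm (D' s) \<le> (M * m + \<rho>) * exp (L * (s - a))"
        by (simp add: algebra_simps)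
    qed
    then show ?thesis by simp
  qed simp
  have "m * exp (L * (x - a)) = norm (D x)"
    by (simp add: m_def w_def mult_exp_exp)
  also have "\<dots> \<le> norm (D a) + norm (D x - D a)"
    by (rule norm_triangle_sub)
  also have "\<dots> \<le> norm (D a) * exp (L * (x - a)) + q * exp (L * (x - a))"
    using main q0 x L mult_left_mono[of 1 "exp (L * (x - a))" "norm (D a)"] by auto
  finally have "m * exp (L * (x - a)) \<le> (norm (D a) + q) * exp (L * (x - a))"
    by (simp add: algebra_simps)
  then have "m \<le> norm (D a) + q" by simp
  \<comment> \<open>The choice of \<open>L\<close> pays off: moving \<open>M * m\<close> to the left
    leaves the factor \<open>M + 1\<close>, while \<open>L\<close> is at most twice that factor.
    This is the origin of the 2 in the conclusion.\<close>
  then have "L * m \<le> L * norm (D a) + (M * m + \<rho>)"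
    using L by (simp add: q_def field_simps)
  then have "(M + 1) * m \<le> (M + 1) * (2 * (norm (D a) + \<rho>))"
    using \<open>0 \<le> M\<close> \<open>0 \<le> \<rho>\<close> mult_nonneg_nonneg[of M \<rho>] norm_ge_zero[of "D a"]
    unfolding L_def ring_distribs by linarith
  then have "m \<le> 2 * (norm (D a) + \<rho>)" using \<open>0 \<le> M\<close> by simp
  then have "m * exp (L * (t - a)) \<le> 2 * (norm (D a) + \<rho>) * exp (L * (t - a))"
    by (rule mult_right_mono) simp
  with le[OF t] show ?thesis unfolding L_def by (rule order_trans)
qed

lemma continuous_has_primitive:
  fixes f :: "real \<Rightarrow> 'b::banach"
  assumes "continuous_on UNIV f"
  obtains F where "F 0 = 0" "\<And>t. (F has_vector_derivative f t) (at t)"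
proof -
  \<comment> \<open>This is the oriented integral from 0 to \<open>t\<close>: for nonzero
    \<open>t\<close> one of the two intervals is empty and contributes 0.\<close>
  define F where "F t = integral {0..t} f - integral {t..0} f" for t
  have "(F has_vector_derivative f t) (at t)" for t
  proof -
    \<comment> \<open>Near \<open>t\<close>, \<open>F\<close> differs by a constant from the
      integral started at \<open>-n\<close>, and \<open>t\<close> is interior to
      \<open>{-n..n}\<close>, so the derivative within the interval is a two-sided one.\<close>
    define n where "n = \<bar>t\<bar> + 1"
    have cont: "continuous_on S f" for S
      using assms by (rule continuous_on_subset) simp
    have int: "f integrable_on {c..d}" for c d
      by (rule integrable_continuous_real[OF cont])
    have F: "integral {-n..u} f - integral {-n..0} f = F u" if "u \<in> {-n<..<n}" for u
    proof (cases "0 \<le> u")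
      case True
      then show ?thesis
        using Henstock_Kurzweil_Integration.integral_combine[OF _ True int, of "-n"]
        by (cases "u = 0") (auto simp: F_def n_def algebra_simps)
    next
      case False
      then show ?thesis
        using Henstock_Kurzweil_Integration.integral_combine[of "-n" u 0 f, OF _ _ int] that
        by (auto simp: F_def n_def algebra_simps)
    qed
    have t: "t \<in> {-n..n}" "t \<in> {-n<..<n}" by (auto simp: n_def)
    have "((\<lambda>u. integral {-n..u} f) has_vector_derivative f t) (at t within {-n..n})"
      by (rule integral_has_vector_derivative[OF cont t(1)])
    then have "((\<lambda>u. integral {-n..u} f) has_vector_derivative f t) (at t)"
      using t at_within_interior[of t "{-n..n}"] by simp
    then have "((\<lambda>u. integral {-n..u} f - integral {-n..0} f) has_vector_derivative f t) (at t)"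
      by (simp add: has_vector_derivative_diff_const)
    then show ?thesis
      by (rule has_vector_derivative_transform_within_open[OF _ _ t(2)]) (auto simp: F)
  qed
  then show thesis by (rule that[rotated]) (simp add: F_def)
qed

text \<open>Integrating the weight \<open>exp (L * \<bar>t\<bar>)\<close> from 0 gains the factor
  \<open>1 / L\<close>. This gain is what turns the Picard map into a contraction.\<close>

lemma norm_primitive_le_exp_weight:
  fixes F :: "real \<Rightarrow> 'b::real_normed_vector"
  assumes der: "\<And>t. (F has_vector_derivative f t) (at t)" and "F 0 = 0"
    and bound: "\<And>t. norm (f t) \<le> c * exp (L * \<bar>t\<bar>)" and "L > 0"
  shows "norm (F t) \<le> c / L * exp (L * \<bar>t\<bar>)"
proof -
  have c: "0 \<le> c" using bound[of 0] norm_ge_zero[of "f 0"] by (simp del: norm_ge_zero)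
  \<comment> \<open>Stated for an arbitrary function, so that negative times follow by applying it
    to the reflection of \<open>F\<close>.\<close>
  have pos: "norm (G u) \<le> c / L * exp (L * u)"
    if G: "\<And>s. (G has_vector_derivative g s) (at s)" "G 0 = 0"
      and g: "\<And>s. norm (g s) \<le> c * exp (L * \<bar>s\<bar>)" and "0 < u"
    for G :: "real \<Rightarrow> 'b" and g u
  proof -
    have "norm (G u - G 0) \<le> c / L * exp (L * u) - c / L * exp (L * 0)"
    proof (rule differentiable_bound_general[OF \<open>0 < u\<close>])
      show "continuous_on {0..u} G"
        using G(1) by (meson continuous_at_imp_continuous_on has_vector_derivative_continuous)
      show "continuous_on {0..u} (\<lambda>s. c / L * exp (L * s))"
        by (intro continuous_intros)
      fix s :: real assume s: "0 < s"
      show "(G has_vector_derivative g s) (at s)" by fact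
      show "((\<lambda>s. c / L * exp (L * s)) has_vector_derivative c * exp (L * s)) (at s)"
        unfolding has_real_derivative_iff_has_vector_derivative[symmetric]
        using \<open>L > 0\<close> by (auto intro!: derivative_eq_intros)
      show "norm (g s) \<le> c * exp (L * s)" using g[of s] s by simp
    qed
    moreover have "0 \<le> c / L" using c \<open>L > 0\<close> by simp
    ultimately show ?thesis using G(2) by simp
  qed
  consider "t = 0" | "t > 0" | "t < 0" by linarith
  then show ?thesis
  proof cases
    case 1
    then show ?thesis using c \<open>L > 0\<close> \<open>F 0 = 0\<close> by simp
  next
    case 2
    then show ?thesis using pos[of F f t] assms by simp
  next
    case 3
    have "((\<lambda>s. F (- s)) has_vector_derivative - f (- s)) (at s)" for s
      using vector_diff_chain_at[of uminus "-1" s F, OF _ der]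
      by (simp add: o_def has_vector_derivative_minus)
    then show ?thesis
      using pos[of "\<lambda>s. F (- s)" "\<lambda>s. - f (- s)" "- t"] bound[of "- _"] \<open>F 0 = 0\<close> 3 by simp
  qed
qed

section \<open>Linear equations with bounded coefficients and their evolution operators\<close>

lemmas has_vector_derivative_blinfun_compose =
  bounded_bilinear.has_vector_derivative[OF bounded_bilinear_blinfun_compose]

lemma blinfun_compose_assoc: "(A o\<^sub>L B) o\<^sub>L C = A o\<^sub>L (B o\<^sub>L C)"
  by (rule blinfun_eqI) simp

lemma blinfun_compose_id [simp]: "id_blinfun o\<^sub>L A = A" "A o\<^sub>L id_blinfun = A"
  by (rule blinfun_eqI, simp)+

lemma norm_blinfun_compose_le:
  "norm A \<le> M \<Longrightarrow> norm (A o\<^sub>L B) \<le> M * norm B"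
  by (meson norm_blinfun_compose order_trans mult_right_mono norm_ge_zero)

text \<open>Used for \<open>A\<close> with bound \<open>M\<close>, for time shifts of
  \<open>A\<close> with the same bound, and for the perturbed coefficient with bound
  \<open>2 * M\<close>.\<close>

locale bounded_coefficient =
  fixes A :: "real \<Rightarrow> 'a::banach \<Rightarrow>\<^sub>L 'a" and M :: real
  assumes cont: "continuous_on UNIV A" and bound: "norm (A t) \<le> M"
begin

lemma M_nonneg: "0 \<le> M"
  using bound[of 0] norm_ge_zero[of "A 0"] by (rule order_trans[rotated])

text \<open>
  Picard iteration as one global contraction: the unknown is weighted by $e^{-L|t|}$ with
  $L = M + 1$ (Bielecki's norm), which makes the contraction constant $M/L$ on the whole line.
\<close>
lemma solution_exists_at_0: "\<exists>X. operator_solution A X"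
proof -
  define L where "L = M + 1"
  have L: "L > 0" using M_nonneg by (simp add: L_def)
  \<comment> \<open>The bounded continuous \<open>Y\<close> stands for the possibly growing
    candidate solution \<open>exp (L * \<bar>t\<bar>) *\<^sub>R Y t\<close>, so the supremum
    distance of such \<open>Y\<close> is Bielecki's distance of the candidates; \<open>f Y\<close>
    is the right-hand side of the equation.\<close>
  define f where "f Y t = A t o\<^sub>L (exp (L * \<bar>t\<bar>) *\<^sub>R apply_bcontfun Y t)"
    for Y :: "real \<Rightarrow>\<^sub>C ('a \<Rightarrow>\<^sub>L 'a)" and t
  have contf: "continuous_on UNIV (f Y)" for Y
    unfolding f_def
    by (intro bounded_bilinear.continuous_on[OF bounded_bilinear_blinfun_compose]
        continuous_intros cont) auto
  have "\<exists>F. F 0 = 0 \<and> (\<forall>t. (F has_vector_derivative f Y t) (at t))" for Y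
    using continuous_has_primitive[OF contf[of Y]] by metis
  then obtain P where P0: "\<And>Y. P Y 0 = 0"
    and P: "\<And>Y t. (P Y has_vector_derivative f Y t) (at t)" by metis
  have Pcont: "continuous_on UNIV (P Y)" for Y
    using P by (meson continuous_at_imp_continuous_on has_vector_derivative_continuous)
  have f_le: "norm (f Y t - f Z t) \<le> (M * dist Y Z) * exp (L * \<bar>t\<bar>)" for Y Z t
  proof -
    have "f Y t - f Z t = A t o\<^sub>L (exp (L * \<bar>t\<bar>) *\<^sub>R (Y t - Z t))"
      by (simp add: f_def bounded_bilinear.diff_right[OF bounded_bilinear_blinfun_compose]
          scaleR_diff_right)
    also have "norm \<dots> \<le> M * norm (exp (L * \<bar>t\<bar>) *\<^sub>R (Y t - Z t))"
      by (rule norm_blinfun_compose_le[OF bound])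
    also have "\<dots> \<le> M * (exp (L * \<bar>t\<bar>) * dist Y Z)"
      using dist_bounded[of Y t Z] M_nonneg
      by (intro mult_left_mono) (auto simp: dist_norm)
    finally show ?thesis by (simp add: mult_ac)
  qed
  have P_le: "norm (P Y t - P Z t) \<le> (M * dist Y Z) / L * exp (L * \<bar>t\<bar>)" for Y Z t
    by (rule norm_primitive_le_exp_weight[where F = "\<lambda>t. P Y t - P Z t", OF _ _ f_le L])
      (auto simp: P0 intro!: derivative_intros P)
  \<comment> \<open>The Picard map, with its value divided by the weight again.\<close>
  define \<phi> where "\<phi> Y t = exp (- L * \<bar>t\<bar>) *\<^sub>R (id_blinfun + P Y t)" for Y t
  have cancel: "exp (- L * \<bar>t\<bar>) * (c * exp (L * \<bar>t\<bar>)) = c" for c t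
    by (simp add: exp_minus)
  have P_zero: "P 0 t = 0" for t
    using norm_primitive_le_exp_weight[OF P P0, of 0 0 L t] L by (simp add: f_def)
  have "\<phi> Y \<in> bcontfun" for Y
  proof (rule bcontfun_normI)
    show "continuous_on UNIV (\<phi> Y)"
      unfolding \<phi>_def by (intro continuous_intros Pcont)
    fix t
    have "norm (id_blinfun + P Y t) \<le> 1 + M * dist Y 0 / L * exp (L * \<bar>t\<bar>)"
      using P_le[of Y t 0] norm_blinfun_id_le
      by (intro norm_triangle_le add_mono) (auto simp: P_zero)
    also have "\<dots> \<le> (1 + M * dist Y 0 / L) * exp (L * \<bar>t\<bar>)"
      using L by (simp add: distrib_right)
    finally have "norm (\<phi> Y t) \<le> exp (- L * \<bar>t\<bar>) * ((1 + M * dist Y 0 / L) * exp (L * \<bar>t\<bar>))"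
      unfolding \<phi>_def norm_scaleR by (simp add: mult_left_mono)
    then show "norm (\<phi> Y t) \<le> 1 + M * dist Y 0 / L"
      unfolding cancel .
  qed
  then have apply_\<phi>: "apply_bcontfun (Bcontfun (\<phi> Y)) = \<phi> Y" for Y
    by (rule Bcontfun_inverse)
  have "\<exists>!Y. Bcontfun (\<phi> Y) = Y"
  proof (rule banach_fix_type)
    show "0 \<le> M / L" "M / L < 1" using M_nonneg L by (auto simp: L_def)
    show "\<forall>Y Z. dist (Bcontfun (\<phi> Y)) (Bcontfun (\<phi> Z)) \<le> M / L * dist Y Z"
    proof (intro allI dist_bound)
      fix Y Z t
      have "\<phi> Y t - \<phi> Z t = exp (- L * \<bar>t\<bar>) *\<^sub>R (P Y t - P Z t)"
        by (simp add: \<phi>_def algebra_simps)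
      then have "norm (\<phi> Y t - \<phi> Z t) = exp (- L * \<bar>t\<bar>) * norm (P Y t - P Z t)"
        by simp
      also have "\<dots> \<le> exp (- L * \<bar>t\<bar>) * ((M * dist Y Z) / L * exp (L * \<bar>t\<bar>))"
        by (intro mult_left_mono P_le) simp
      finally show "dist (apply_bcontfun (Bcontfun (\<phi> Y)) t) (apply_bcontfun (Bcontfun (\<phi> Z)) t)
          \<le> M / L * dist Y Z"
        unfolding cancel by (simp add: apply_\<phi> dist_norm)
    qed
  qed
  then obtain Y where "Bcontfun (\<phi> Y) = Y" by blast
  then have "apply_bcontfun Y t = \<phi> Y t" for t by (metis apply_\<phi>)
  \<comment> \<open>Undoing the weight at the fixed point shows that the candidate equals
    \<open>id_blinfun + P Y t\<close>, so the integral equation holds.\<close>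
  then have fix_f: "f Y t = A t o\<^sub>L (id_blinfun + P Y t)" for t
    by (simp add: f_def \<phi>_def mult_exp_exp)
  have "((\<lambda>t. id_blinfun + P Y t) has_vector_derivative A t o\<^sub>L (id_blinfun + P Y t)) (at t)" for t
    using has_vector_derivative_add[OF has_vector_derivative_const[of id_blinfun] P[of Y t]]
    by (simp add: fix_f)
  then have "operator_solution A (\<lambda>t. id_blinfun + P Y t)"
    by (simp add: operator_solution_def P0)
  then show ?thesis by blast
qed

lemma solution_unique:
  assumes X: "\<And>t. (X has_vector_derivative A t o\<^sub>L X t) (at t)"
    and Y: "\<And>t. (Y has_vector_derivative A t o\<^sub>L Y t) (at t)"
    and eq: "X s = Y s"
  shows "X t = Y t"
proof -
  define D where "D t = X t - Y t" for t
  have D: "(D has_vector_derivative A t o\<^sub>L D t) (at t)" for t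
    unfolding D_def bounded_bilinear.diff_right[OF bounded_bilinear_blinfun_compose]
    by (intro derivative_intros X Y)
  have Ds: "D s = 0" by (simp add: D_def eq)
  have "norm (D t) \<le> 0"
  proof (cases "s \<le> t")
    case True
    have "norm (D t) \<le> 2 * (norm (D s) + 0) * exp ((2 * M + 1) * (t - s))"
      by (rule gronwall_perturbed[where b = t and D' = "\<lambda>t. A t o\<^sub>L D t"])
        (use True M_nonneg in \<open>auto intro: has_vector_derivative_at_within D
          norm_blinfun_compose_le bound\<close>)
    then show ?thesis by (simp add: Ds)
  next
    case False
    \<comment> \<open>For times before \<open>s\<close>, reflect time: the coefficient only changes
      sign, which its norm bound does not see, so the same Gronwall estimate applies.\<close>
    have R: "((\<lambda>u. D (- u)) has_vector_derivative - (A (- u) o\<^sub>L D (- u))) (at u)" for u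
      using vector_diff_chain_at[of uminus "-1" u D, OF _ D]
      by (simp add: o_def has_vector_derivative_minus)
    have "norm (D (- (- t))) \<le> 2 * (norm (D (- (- s))) + 0) * exp ((2 * M + 1) * (- t - (- s)))"
      by (rule gronwall_perturbed[where D = "\<lambda>u. D (- u)" and b = "- t"
            and D' = "\<lambda>u. - (A (- u) o\<^sub>L D (- u))"])
        (use False M_nonneg in \<open>auto intro: has_vector_derivative_at_within R
          norm_blinfun_compose_le bound\<close>)
    then show ?thesis by (simp add: Ds)
  qed
  then show ?thesis by (simp add: D_def)
qed

lemma solution_exists:
  obtains Y where "Y s = id_blinfun" "\<And>t. (Y has_vector_derivative A t o\<^sub>L Y t) (at t)"
proof -
  interpret shifted: bounded_coefficient "\<lambda>t. A (t + s)" M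
    by unfold_locales (auto intro!: bound continuous_on_compose2[OF cont] continuous_intros)
  obtain X where X: "operator_solution (\<lambda>t. A (t + s)) X"
    using shifted.solution_exists_at_0 by blast
  show thesis
  proof (rule that[of "\<lambda>t. X (t - s)"])
    show "X (s - s) = id_blinfun" using X by (simp add: operator_solution_def)
    show "((\<lambda>t. X (t - s)) has_vector_derivative A t o\<^sub>L X (t - s)) (at t)" for t
    proof -
      have "((\<lambda>t. t - s) has_vector_derivative 1) (at t)"
        by (auto intro!: derivative_eq_intros)
      moreover have "(X has_vector_derivative A t o\<^sub>L X (t - s)) (at (t - s))"
        using X[unfolded operator_solution_def, THEN conjunct2, rule_format, of "t - s"] by simp
      ultimately show ?thesis
        using vector_diff_chain_at[of "\<lambda>t. t - s" 1 t X] by (simp add: o_def)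
    qed
  qed
qed

lemma operator_solution_fundamental: "operator_solution A (fundamental_operator A)"
proof -
  have "\<exists>!X. operator_solution A X"
  proof (rule ex_ex1I)
    fix X Y assume "operator_solution A X" "operator_solution A Y"
    then have "X t = Y t" for t
      by (intro solution_unique[of X Y 0 t]) (simp_all add: operator_solution_def)
    then show "X = Y" by (rule ext)
  qed (rule solution_exists_at_0)
  then show ?thesis unfolding fundamental_operator_def by (rule theI')
qed

text \<open>Removes both definite descriptions from all later arguments. Multiplying a solution on
  the right by a constant operator gives a solution, so uniqueness relates \<open>Y\<close> to the
  fundamental operator and exhibits \<open>Y 0\<close> as the inverse of the latter at
  \<open>s\<close>.\<close>

lemma evolution_operator_solution:
  assumes "Y s = id_blinfun" "\<And>t. (Y has_vector_derivative A t o\<^sub>L Y t) (at t)"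
  shows "evolution_operator A t s = Y t"
proof -
  let ?X = "fundamental_operator A"
  have X0: "?X 0 = id_blinfun" and X: "(?X has_vector_derivative A t o\<^sub>L ?X t) (at t)" for t
    using operator_solution_fundamental by (auto simp: operator_solution_def)
  have right: "((\<lambda>t. Z t o\<^sub>L U) has_vector_derivative A t o\<^sub>L (Z t o\<^sub>L U)) (at t)"
    if "\<And>t. (Z has_vector_derivative A t o\<^sub>L Z t) (at t)" for Z and U :: "'a \<Rightarrow>\<^sub>L 'a" and t
    using has_vector_derivative_blinfun_compose[OF that has_vector_derivative_const[of U]]
    by (simp add: blinfun_compose_assoc)
  have 1: "Y t o\<^sub>L ?X s = ?X t" for t
    by (rule solution_unique[of _ _ s]) (auto intro: X right assms simp: assms(1))
  have 2: "?X t o\<^sub>L Y 0 = Y t" for t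
    by (rule solution_unique[of _ _ 0]) (auto intro: X right assms simp: X0)
  \<comment> \<open>In infinite dimension a one-sided inverse would not suffice; the two identities,
    evaluated at \<open>s\<close> and at 0, give one side each.\<close>
  have inv: "?X s o\<^sub>L Y 0 = id_blinfun" "Y 0 o\<^sub>L ?X s = id_blinfun"
    using 1[of 0] 2[of s] by (simp_all add: X0 assms(1))
  have "inverse_operator (?X s) = Y 0"
    unfolding inverse_operator_def
  proof (rule the_equality)
    fix V assume "?X s o\<^sub>L V = id_blinfun \<and> V o\<^sub>L ?X s = id_blinfun"
    then have "V = V o\<^sub>L (?X s o\<^sub>L Y 0)" "Y 0 = (V o\<^sub>L ?X s) o\<^sub>L Y 0"
      by (simp_all add: inv)
    then show "V = Y 0" by (simp add: blinfun_compose_assoc)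
  qed (simp add: inv)
  then show ?thesis by (simp add: evolution_operator_def 2)
qed

lemma evolution_operator_self [simp]: "evolution_operator A s s = id_blinfun"
  by (metis evolution_operator_solution solution_exists)

lemma evolution_operator_has_derivative:
  "((\<lambda>t. evolution_operator A t s) has_vector_derivative
     A t o\<^sub>L evolution_operator A t s) (at t)"
proof -
  obtain Y where Y: "Y s = id_blinfun" "\<And>t. (Y has_vector_derivative A t o\<^sub>L Y t) (at t)"
    using solution_exists[of s] by blast
  then have "(\<lambda>t. evolution_operator A t s) = Y"
    using evolution_operator_solution by blast
  with Y(2) show ?thesis by (simp add: fun_eq_iff)
qed

text \<open>As functions of \<open>t\<close> both sides solve the equation and agree at
  \<open>r\<close>, so uniqueness applies, whatever the order of the three times.\<close>

lemma evolution_operator_compose: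
  "evolution_operator A t r o\<^sub>L evolution_operator A r s = evolution_operator A t s"
proof (rule solution_unique[where s = r and Y = "\<lambda>t. evolution_operator A t s"
      and X = "\<lambda>t. evolution_operator A t r o\<^sub>L evolution_operator A r s"])
  show "((\<lambda>t. evolution_operator A t r o\<^sub>L evolution_operator A r s) has_vector_derivative
      A t o\<^sub>L (evolution_operator A t r o\<^sub>L evolution_operator A r s)) (at t)" for t
    using has_vector_derivative_blinfun_compose[OF evolution_operator_has_derivative
        has_vector_derivative_const[of "evolution_operator A r s"]]
    by (simp add: blinfun_compose_assoc)
qed (auto intro: evolution_operator_has_derivative)

lemma norm_evolution_operator_le:
  assumes "s \<le> t"
  shows "norm (evolution_operator A t s) \<le> 2 * exp ((2 * M + 1) * (t - s))"
proof -
  have "norm (evolution_operator A t s)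
      \<le> 2 * (norm (evolution_operator A s s) + 0) * exp ((2 * M + 1) * (t - s))"
    by (rule gronwall_perturbed[where b = t and D' = "\<lambda>t. A t o\<^sub>L evolution_operator A t s"])
      (use assms M_nonneg in \<open>auto intro: has_vector_derivative_at_within
        evolution_operator_has_derivative norm_blinfun_compose_le bound\<close>)
  \<comment> \<open>Only an inequality is available for the norm of the identity, which is 0 on the
    trivial space.\<close>
  also have "\<dots> \<le> 2 * 1 * exp ((2 * M + 1) * (t - s))"
    using norm_blinfun_id_le[where 'a = 'a] by (intro mult_right_mono mult_left_mono) auto
  finally show ?thesis by simp
qed

end

section \<open>Averaging estimate on a single window\<close>

text \<open>The perturbation \<open>C\<close> may be large; only its primitive \<open>G\<close> from
  \<open>s\<close> has to be small. In the constant, the first factor bounds the perturbed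
  evolution, the term with \<open>6 * M\<close> is the Gronwall error for the transformed solution,
  and the final 1 pays for undoing the transformation.\<close>

lemma evolution_operator_perturbation:
  fixes A C :: "real \<Rightarrow> 'a::banach \<Rightarrow>\<^sub>L 'a"
  assumes "bounded_coefficient A M" "bounded_coefficient (\<lambda>t. A t + C t) (2 * M)"
    and G: "\<And>t. (G has_vector_derivative C t) (at t)" "G s = 0"
    and small: "\<And>t. t \<in> {s..s + h} \<Longrightarrow> norm (G t) \<le> \<eta>"
    and t: "t \<in> {s..s + h}"
  shows "norm (evolution_operator (\<lambda>t. A t + C t) t s - evolution_operator A t s)
    \<le> \<eta> * (2 * exp ((4 * M + 1) * h) * (6 * M * exp ((2 * M + 1) * h) + 1))"
proof -
  interpret A: bounded_coefficient A M by fact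
  interpret AC: bounded_coefficient "\<lambda>t. A t + C t" "2 * M" by fact
  note M = A.M_nonneg
  define S where "S u = evolution_operator (\<lambda>t. A t + C t) u s" for u
  define T where "T u = evolution_operator A u s" for u
  define \<sigma> where "\<sigma> = 2 * exp ((4 * M + 1) * h)"
  define V where "V u = S u - (G u o\<^sub>L S u)" for u
  define R where "R u = (A u o\<^sub>L (G u o\<^sub>L S u)) - (G u o\<^sub>L ((A u + C u) o\<^sub>L S u))" for u
  have \<eta>: "0 \<le> \<eta>" by (rule order_trans[OF norm_ge_zero small[OF t]])
  have \<sigma>: "0 \<le> \<sigma>" by (simp add: \<sigma>_def)
  have S_le: "norm (S u) \<le> \<sigma>" if "u \<in> {s..s + h}" for u
  proof -
    have "norm (S u) \<le> 2 * exp ((2 * (2 * M) + 1) * (u - s))"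
      unfolding S_def by (rule AC.norm_evolution_operator_le) (use that in simp)
    also have "\<dots> \<le> \<sigma>"
      unfolding \<sigma>_def using that M by (auto intro!: mult_mono)
    finally show ?thesis .
  qed
  have GS_le: "norm (G u o\<^sub>L S u) \<le> \<eta> * \<sigma>" if "u \<in> {s..s + h}" for u
    using norm_blinfun_compose_le[OF small[OF that]] mult_left_mono[OF S_le[OF that] \<eta>]
    by (rule order_trans)
  \<comment> \<open>One \<open>M\<close> comes from \<open>A\<close>, and \<open>2 * M\<close> from
    the bound on \<open>A + C\<close>.\<close>
  have R_le: "norm (R u) \<le> 3 * M * \<eta> * \<sigma>" if "u \<in> {s..s + h}" for u
  proof -
    have "norm (A u o\<^sub>L (G u o\<^sub>L S u)) \<le> M * (\<eta> * \<sigma>)"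
      using norm_blinfun_compose_le[OF A.bound] mult_left_mono[OF GS_le[OF that] M]
      by (rule order_trans)
    moreover have "norm ((A u + C u) o\<^sub>L S u) \<le> 2 * M * \<sigma>"
      using norm_blinfun_compose_le[OF AC.bound]
        mult_left_mono[OF S_le[OF that] AC.M_nonneg] by (rule order_trans)
    from norm_blinfun_compose_le[OF small[OF that]] mult_left_mono[OF this \<eta>]
    have "norm (G u o\<^sub>L ((A u + C u) o\<^sub>L S u)) \<le> \<eta> * (2 * M * \<sigma>)"
      by (rule order_trans)
    ultimately have "norm (A u o\<^sub>L (G u o\<^sub>L S u)) + norm (G u o\<^sub>L ((A u + C u) o\<^sub>L S u))
        \<le> 3 * M * \<eta> * \<sigma>"
      by (simp add: algebra_simps)
    then show ?thesis
      unfolding R_def by (rule norm_triangle_le_diff)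
  qed
  have S': "(S has_vector_derivative (A u + C u) o\<^sub>L S u) (at u)" for u
    unfolding S_def by (rule AC.evolution_operator_has_derivative)
  have T': "(T has_vector_derivative A u o\<^sub>L T u) (at u)" for u
    unfolding T_def by (rule A.evolution_operator_has_derivative)
  have VT': "((\<lambda>u. V u - T u) has_vector_derivative (A u o\<^sub>L (V u - T u)) + R u) (at u)" for u
  proof -
    have "((\<lambda>u. V u - T u) has_vector_derivative (((A u + C u) o\<^sub>L S u)
        - ((G u o\<^sub>L ((A u + C u) o\<^sub>L S u)) + (C u o\<^sub>L S u))) - (A u o\<^sub>L T u)) (at u)"
      unfolding V_def
      by (intro has_vector_derivative_diff has_vector_derivative_blinfun_compose S' T' G)
    \<comment> \<open>The point of the transformation: differentiating \<open>G\<close> produces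
      \<open>C u o\<^sub>L S u\<close>, which cancels the perturbation in the derivative of
      \<open>S\<close>. Every term of the remainder \<open>R\<close> carries a factor
      \<open>G\<close>.\<close>
    moreover have "(((A u + C u) o\<^sub>L S u)
        - ((G u o\<^sub>L ((A u + C u) o\<^sub>L S u)) + (C u o\<^sub>L S u))) - (A u o\<^sub>L T u)
        = (A u o\<^sub>L (V u - T u)) + R u"
      by (simp add: V_def R_def bounded_bilinear.diff_right[OF bounded_bilinear_blinfun_compose]
          bounded_bilinear.add_left[OF bounded_bilinear_blinfun_compose])
    ultimately show ?thesis by simp
  qed
  have VTs: "V s - T s = 0" by (simp add: V_def S_def T_def G)
  have "norm (V t - T t)
      \<le> 2 * (norm (V s - T s) + 3 * M * \<eta> * \<sigma>) * exp ((2 * M + 1) * (t - s))"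
  proof (rule gronwall_perturbed[where b = "s + h" and D' = "\<lambda>u. (A u o\<^sub>L (V u - T u)) + R u"])
    fix u assume u: "u \<in> {s..s + h}"
    show "norm ((A u o\<^sub>L (V u - T u)) + R u) \<le> M * norm (V u - T u) + 3 * M * \<eta> * \<sigma>"
      by (intro norm_triangle_le add_mono norm_blinfun_compose_le A.bound R_le u)
  qed (use M \<eta> \<sigma> t in \<open>auto intro: has_vector_derivative_at_within VT'\<close>)
  also have "\<dots> \<le> 2 * (3 * M * \<eta> * \<sigma>) * exp ((2 * M + 1) * h)"
    unfolding VTs using M \<eta> \<sigma> t by (auto intro!: mult_left_mono)
  finally have "norm (V t - T t) \<le> 2 * (3 * M * \<eta> * \<sigma>) * exp ((2 * M + 1) * h)" .
  moreover have "norm (S t - T t) \<le> norm (V t - T t) + norm (G t o\<^sub>L S t)"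
    using norm_triangle_ineq[of "V t - T t" "G t o\<^sub>L S t"] by (simp add: V_def)
  ultimately have "norm (S t - T t) \<le> 2 * (3 * M * \<eta> * \<sigma>) * exp ((2 * M + 1) * h) + \<eta> * \<sigma>"
    using GS_le[OF t] by linarith
  then show ?thesis
    unfolding S_def T_def \<sigma>_def[symmetric] by (simp add: algebra_simps)
qed

section \<open>From one window to all times, and increments of primitives\<close>

text \<open>Split \<open>t - s\<close> into whole windows and a remainder shorter than
  \<open>h\<close>. Each whole window contributes \<open>exp (- \<beta> * h)\<close>, the remainder
  costs \<open>c\<close>, and replacing the covered length by \<open>t - s\<close> costs at most
  \<open>exp (\<beta> * h)\<close>.\<close>

lemma exponential_decay_from_window:
  fixes E :: "real \<Rightarrow> real \<Rightarrow> 'a::real_normed_vector \<Rightarrow>\<^sub>L 'a"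
  assumes cocycle: "\<And>t r s. E t r o\<^sub>L E r s = E t s"
    and window: "\<And>t s. s \<le> t \<Longrightarrow> t \<le> s + h \<Longrightarrow> norm (E t s) \<le> c"
    and self: "\<And>s. norm (E s s) \<le> 1"
    and step: "\<And>s. norm (E (s + h) s) \<le> exp (- \<beta> * h)"
    and "0 < h" "0 \<le> \<beta>" "s \<le> t"
  shows "norm (E t s) \<le> c * exp (\<beta> * h) * exp (- \<beta> * (t - s))"
proof -
  have c: "0 \<le> c" using order_trans[OF norm_ge_zero window[of 0 0]] \<open>0 < h\<close> by simp
  have iter: "norm (E (s + real n * h) s) \<le> exp (- \<beta> * (real n * h))" for n
  proof (induction n)
    case (Suc n)
    have "E (s + real (Suc n) * h) s
        = E (s + real n * h + h) (s + real n * h) o\<^sub>L E (s + real n * h) s"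
      by (simp add: cocycle algebra_simps)
    also have "norm \<dots> \<le> exp (- \<beta> * h) * exp (- \<beta> * (real n * h))"
      using norm_blinfun_compose_le[OF step] mult_left_mono[OF Suc.IH exp_ge_zero]
      by (rule order_trans)
    finally show ?case by (simp add: mult_exp_exp algebra_simps)
  qed (use self in simp)
  define n where "n = nat \<lfloor>(t - s) / h\<rfloor>"
  have "real n \<le> (t - s) / h" "(t - s) / h < real n + 1"
    using \<open>s \<le> t\<close> \<open>0 < h\<close> by (auto simp: n_def intro!: of_nat_floor)
  then have n: "real n * h \<le> t - s" "t - s \<le> real n * h + h"
    using \<open>0 < h\<close> by (auto simp: field_simps)
  have "norm (E t s) = norm (E t (s + real n * h) o\<^sub>L E (s + real n * h) s)"
    by (simp add: cocycle)
  also have "\<dots> \<le> c * exp (- \<beta> * (real n * h))"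
    using norm_blinfun_compose_le[OF window] mult_left_mono[OF iter c]
    by (rule order_trans) (use n in auto)
  also have "\<dots> \<le> c * exp (\<beta> * h + - \<beta> * (t - s))"
    using mult_left_mono[OF n(2) \<open>0 \<le> \<beta>\<close>] c by (intro mult_left_mono) (auto simp: algebra_simps)
  finally show ?thesis by (simp only: exp_add mult.assoc)
qed

text \<open>Long increments are controlled by the mean value and give the first term; short ones are
  controlled by the trivial bound and give the second. After division by a large frequency \<omega>,
  with \<open>u\<close> at most \<open>\<omega> * h\<close>, both become small.\<close>

lemma norm_primitive_increment_le:
  fixes F :: "real \<Rightarrow> 'b::banach"
  assumes F: "\<And>t. (F has_vector_derivative f t) (at t)"
    and bound: "\<And>t. norm (f t) \<le> M"
    and mean: "\<And>T a. T \<ge> T\<^sub>0 \<Longrightarrow> norm ((1 / T) *\<^sub>R integral {a..a + T} f) \<le> \<epsilon>"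
    and "0 < T\<^sub>0" "0 \<le> u"
  shows "norm (F (a + u) - F a) \<le> \<epsilon> * u + M * T\<^sub>0"
proof -
  have "(f has_integral F (a + u) - F a) {a..a + u}"
    using \<open>0 \<le> u\<close> by (intro fundamental_theorem_of_calculus)
      (auto intro: has_vector_derivative_at_within F)
  then have int: "integral {a..a + u} f = F (a + u) - F a" "f integrable_on {a..a + u}"
    by (auto simp: integral_unique)
  have M: "0 \<le> M" and \<epsilon>: "0 \<le> \<epsilon>"
    using order_trans[OF norm_ge_zero bound[of 0]]
      order_trans[OF norm_ge_zero mean[of T\<^sub>0 0]] by simp_all
  show ?thesis
  proof (cases "T\<^sub>0 \<le> u")
    case True
    then have "norm (integral {a..a + u} f) \<le> \<epsilon> * u"
      using mean[OF True, of a] \<open>0 < T\<^sub>0\<close> by (simp add: field_simps)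
    then show ?thesis using M \<open>0 < T\<^sub>0\<close> by (simp add: int add_increasing2)
  next
    case False
    have "norm (F (a + u) - F a) \<le> M * norm (a + u - a)"
      by (rule differentiable_bound[where S = UNIV and f' = "\<lambda>x h. h *\<^sub>R f x"])
        (use F bound in \<open>auto simp: has_vector_derivative_def onorm_scaleR_left
          onorm_id intro!: onorm_bound M mult_right_mono\<close>)
    also have "\<dots> \<le> M * T\<^sub>0" using False M \<open>0 \<le> u\<close> by (intro mult_left_mono) auto
    finally show ?thesis using \<epsilon> \<open>0 \<le> u\<close> by (simp add: add_increasing)
  qed
qed

section \<open>Choice of the constants and uniform decay at high frequency\<close>

theorem theorem7:
  fixes A B :: "real \<Rightarrow> 'a::banach \<Rightarrow>\<^sub>L 'a" and M K \<alpha> :: real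
  assumes "continuous_on UNIV A" and "continuous_on UNIV B"
    and "\<And>t. norm (A t) \<le> M" and "\<And>t. norm (B t) \<le> M"
    and "generalized_almost_periodic B" and "has_mean_value B 0"
    and "\<alpha> > 0" and "K > 1"
    and "\<And>t s. t \<ge> s \<Longrightarrow> norm (evolution_operator A t s) \<le> K * exp (- \<alpha> * (t - s))"
  shows "\<exists>K' \<omega>\<^sub>0. K' > 0 \<and> \<omega>\<^sub>0 > 0 \<and>
    (\<forall>\<omega>>\<omega>\<^sub>0. \<forall>t s. t \<ge> s \<longrightarrow>
       norm (evolution_operator (\<lambda>\<tau>. A \<tau> + B (\<omega> * \<tau>)) t s)
         \<le> K' * exp (- (\<alpha> / 2) * (t - s)))"
proof -
  interpret A: bounded_coefficient A M by unfold_locales fact+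
  note M = A.M_nonneg
  \<comment> \<open>The target for one window, \<open>exp (- (\<alpha> / 2) * h)\<close>, becomes
    \<open>1 / (2 * K)\<close>, and the unperturbed bound \<open>1 / (4 * K)\<close> uses exactly
    half of it. The other half is left for the perturbation.\<close>
  define h where "h = 2 * ln (2 * K) / \<alpha>"
  have h: "0 < h" using \<open>\<alpha> > 0\<close> \<open>K > 1\<close> by (simp add: h_def)
  have exp_h: "exp (- (\<alpha> / 2) * h) = 1 / (2 * K)"
    using \<open>\<alpha> > 0\<close> \<open>K > 1\<close> by (simp add: h_def exp_minus inverse_eq_divide)
  have step_A: "K * exp (- \<alpha> * h) = 1 / (4 * K)"
  proof -
    have "exp (- \<alpha> * h) = exp (- (\<alpha> / 2) * h) * exp (- (\<alpha> / 2) * h)"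
      by (simp add: mult_exp_exp)
    then show ?thesis unfolding exp_h using \<open>K > 1\<close> by simp
  qed
  define \<sigma> where "\<sigma> = 2 * exp ((4 * M + 1) * h)"
  \<comment> \<open>The factor of \<open>\<eta>\<close> in the averaging estimate;
    \<open>\<eta>\<close> is then chosen so that the deviation is at most
    \<open>1 / (4 * K)\<close>.\<close>
  define k where "k = \<sigma> * (6 * M * exp ((2 * M + 1) * h) + 1)"
  have "0 < k" using M by (auto simp: k_def \<sigma>_def intro!: mult_pos_pos add_nonneg_pos)
  define \<eta> where "\<eta> = 1 / (4 * K) / k"
  have \<eta>: "0 < \<eta>" "\<eta> * k = 1 / (4 * K)"
    using \<open>0 < k\<close> \<open>K > 1\<close> by (auto simp: \<eta>_def)
  \<comment> \<open>Over one window the mean value part of the primitive is at most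
    \<open>\<epsilon> * h\<close>, half of \<open>\<eta>\<close>.\<close>
  define \<epsilon> where "\<epsilon> = \<eta> / (2 * h)"
  have "0 < \<epsilon>" using \<eta> h by (simp add: \<epsilon>_def)
  with \<open>has_mean_value B 0\<close> obtain T\<^sub>0 where "0 < T\<^sub>0"
    and mean: "\<And>T a. T \<ge> T\<^sub>0 \<Longrightarrow> norm ((1 / T) *\<^sub>R integral {a..a + T} B) < \<epsilon>"
    unfolding has_mean_value_def diff_zero by meson
  obtain F where F: "\<And>t. (F has_vector_derivative B t) (at t)"
    using continuous_has_primitive[OF \<open>continuous_on UNIV B\<close>] by blast
  \<comment> \<open>Makes the short-time part \<open>M * T\<^sub>0 / \<omega>\<close> at most the
    other half of \<open>\<eta>\<close>; the added 1 keeps the threshold positive when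
    \<open>M\<close> is 0. It is independent of \<open>s\<close> because \<open>T\<^sub>0\<close>
    serves every starting point \<open>a\<close>.\<close>
  define \<omega>\<^sub>0 where "\<omega>\<^sub>0 = 2 * M * T\<^sub>0 / \<eta> + 1"
  have \<omega>\<^sub>0: "0 < \<omega>\<^sub>0" using M \<open>0 < T\<^sub>0\<close> \<eta> by (simp add: \<omega>\<^sub>0_def add_nonneg_pos)
  have "norm (evolution_operator (\<lambda>\<tau>. A \<tau> + B (\<omega> * \<tau>)) t s)
      \<le> \<sigma> * exp (\<alpha> / 2 * h) * exp (- (\<alpha> / 2) * (t - s))"
    if "\<omega> > \<omega>\<^sub>0" "s \<le> t" for \<omega> t s
  proof (rule exponential_decay_from_window)
    define E where "E = evolution_operator (\<lambda>\<tau>. A \<tau> + B (\<omega> * \<tau>))"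
    have \<omega>: "0 < \<omega>" using that \<omega>\<^sub>0 by simp
    have AC: "bounded_coefficient (\<lambda>\<tau>. A \<tau> + B (\<omega> * \<tau>)) (2 * M)"
    proof
      show "continuous_on UNIV (\<lambda>\<tau>. A \<tau> + B (\<omega> * \<tau>))"
        by (intro continuous_intros assms(1) continuous_on_compose2[OF assms(2)]) auto
      show "norm (A \<tau> + B (\<omega> * \<tau>)) \<le> 2 * M" for \<tau>
        using norm_triangle_mono[OF assms(3,4)[of "_"]] by simp
    qed
    then interpret AC: bounded_coefficient "\<lambda>\<tau>. A \<tau> + B (\<omega> * \<tau>)" "2 * M" .
    show "evolution_operator (\<lambda>\<tau>. A \<tau> + B (\<omega> * \<tau>)) t r
        o\<^sub>L evolution_operator (\<lambda>\<tau>. A \<tau> + B (\<omega> * \<tau>)) r s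
        = evolution_operator (\<lambda>\<tau>. A \<tau> + B (\<omega> * \<tau>)) t s" for t r s
      by (rule AC.evolution_operator_compose)
    show "norm (evolution_operator (\<lambda>\<tau>. A \<tau> + B (\<omega> * \<tau>)) s s) \<le> 1" for s
      by (simp add: norm_blinfun_id_le)
    show "norm (evolution_operator (\<lambda>\<tau>. A \<tau> + B (\<omega> * \<tau>)) t s) \<le> \<sigma>"
      if "s \<le> t" "t \<le> s + h" for t s
    proof -
      have "2 * exp ((2 * (2 * M) + 1) * (t - s)) \<le> \<sigma>"
        using that M by (auto simp: \<sigma>_def intro!: mult_mono)
      with AC.norm_evolution_operator_le[OF that(1)] show ?thesis by (rule order_trans)
    qed
    show "norm (evolution_operator (\<lambda>\<tau>. A \<tau> + B (\<omega> * \<tau>)) (s + h) s) \<le> exp (- (\<alpha> / 2) * h)"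
      for s
    proof -
      \<comment> \<open>The primitive of the fast perturbation from \<open>s\<close>, after the
        substitution of \<open>\<omega> * \<tau>\<close> for the time variable.\<close>
      define G where "G t = (1 / \<omega>) *\<^sub>R (F (\<omega> * t) - F (\<omega> * s))" for t
      have G': "(G has_vector_derivative B (\<omega> * t)) (at t)" for t
      proof -
        have "((*) \<omega> has_vector_derivative \<omega>) (at t)"
          by (auto intro!: derivative_eq_intros
              simp: has_real_derivative_iff_has_vector_derivative[symmetric])
        from vector_diff_chain_at[OF this F]
        have "((\<lambda>t. F (\<omega> * t)) has_vector_derivative \<omega> *\<^sub>R B (\<omega> * t)) (at t)"
          by (simp add: o_def)
        then have "((\<lambda>t. (1 / \<omega>) *\<^sub>R (F (\<omega> * t) - F (\<omega> * s))) has_vector_derivative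
            (1 / \<omega>) *\<^sub>R (\<omega> *\<^sub>R B (\<omega> * t))) (at t)"
          by (intro bounded_linear.has_vector_derivative[OF bounded_linear_scaleR_right])
            (simp add: has_vector_derivative_diff_const)
        then show ?thesis using \<omega> by (simp add: G_def[abs_def])
      qed
      have G_le: "norm (G t) \<le> \<eta>" if t: "t \<in> {s..s + h}" for t
      proof -
        have "norm (F (\<omega> * s + \<omega> * (t - s)) - F (\<omega> * s)) \<le> \<epsilon> * (\<omega> * (t - s)) + M * T\<^sub>0"
          by (rule norm_primitive_increment_le[OF F assms(4)])
            (use mean \<open>0 < T\<^sub>0\<close> \<omega> t in \<open>auto intro: less_imp_le\<close>)
        also have "\<dots> \<le> \<epsilon> * (\<omega> * h) + \<omega> * (\<eta> / 2)"
        proof (rule add_mono)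
          show "\<epsilon> * (\<omega> * (t - s)) \<le> \<epsilon> * (\<omega> * h)"
            using t \<omega> \<open>0 < \<epsilon>\<close> by (intro mult_left_mono) auto
          have "2 * M * T\<^sub>0 / \<eta> \<le> \<omega>" using that \<open>\<omega> > \<omega>\<^sub>0\<close> by (simp add: \<omega>\<^sub>0_def)
          then show "M * T\<^sub>0 \<le> \<omega> * (\<eta> / 2)" using \<eta>(1) by (simp add: field_simps)
        qed
        also have "\<dots> = \<omega> * \<eta>" using h by (simp add: \<epsilon>_def field_simps)
        finally have "norm (F (\<omega> * t) - F (\<omega> * s)) \<le> \<omega> * \<eta>"
          by (simp add: algebra_simps)
        moreover have "norm (G t) = norm (F (\<omega> * t) - F (\<omega> * s)) / \<omega>"
          using \<omega> by (simp only: G_def norm_scaleR) simp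
        ultimately show ?thesis using \<omega> by (simp add: divide_le_eq mult.commute)
      qed
      have "norm (E (s + h) s - evolution_operator A (s + h) s) \<le> \<eta> * k"
        unfolding E_def k_def \<sigma>_def
        by (rule evolution_operator_perturbation[OF A.bounded_coefficient_axioms AC G' _ G_le])
          (use h in \<open>auto simp: G_def\<close>)
      moreover have "norm (evolution_operator A (s + h) s) \<le> 1 / (4 * K)"
        using assms(9)[of s "s + h"] h step_A by simp
      ultimately have "norm (E (s + h) s) \<le> 1 / (4 * K) + 1 / (4 * K)"
        using norm_triangle_sub[of "E (s + h) s" "evolution_operator A (s + h) s"] \<eta>(2)
        by linarith
      then show ?thesis unfolding E_def exp_h by simp
    qed
  qed (use h that \<open>\<alpha> > 0\<close> in auto)
  then show ?thesis
    using \<omega>\<^sub>0 by (intro exI[of _ "\<sigma> * exp (\<alpha> / 2 * h)"] exI[of _ \<omega>\<^sub>0]) (auto simp: \<sigma>_def)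
qed

end
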